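(* Let the interface flux $\bm{f}^*_n = \bm{f}^*_n(\bm{u}_L, \bm{u}_R)$ be skew-symmetric and entropy stable, in the sense that for all states $\bm{u}_L,\bm{u}_R$ and unit normals $\bm{n}$, $$(\bm{v}_L - \bm{v}_R)^T\bm{f}^*_n(\bm{u}_L, \bm{u}_R) \leq \sum_{m=1}^d \left(\psi_m(\bm{u}_L) - \psi_m(\bm{u}_R)\right)n_m, \qquad \bm{f}^*_n(\bm{u}_L, \bm{u}_R) = - \bm{f}^*_{-n}(\bm{u}_R, \bm{u}_L),$$ where $\bm{v}_L = \bm{v}(\bm{u}_L)$ and $\bm{v}_R = \bm{v}(\bm{u}_R)$ are the entropy variables corresponding to $\bm{u}_L,\bm{u}_R$. Let $\tilde{\bm{u}}=\bm{u}(\Pi_N\bm{v}(\bm{u}_h))$ be the entropy projection of the discrete solution $\bm{u}_h$, and suppose the interface flux is evaluated in terms of the entropy projection, $\bm{f}^*_n = \bm{f}^*_n(\tilde{\bm{u}}^+, \tilde{\bm{u}})$. Then the inequality $$\sum_k \left[\left(\frac{\partial S(\bm{u}_h)}{\partial t}, 1\right)_{D^k} + \left\langle (\Pi_N\bm{v}(\bm{u}_h))^T\bm{f}_n^* - \sum_{m=1}^d\psi_m(\tilde{\bm{u}}) n_m, 1\right\rangle_{\partial D^k}\right] \leq 0$$ implies the global entropy inequality $$\left(\frac{\partial S(\bm{u}_h)}{\partial t}, 1\right)_{\Omega} + \left\langle (\Pi_N\bm{v}(\bm{u}_h))^T\bm{f}_n^* - \sum_{m=1}^d\psi_m(\tilde{\bm{u}})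 n_m, 1\right\rangle_{\partial \Omega} \leq 0.$$
   Context: Conservation law: $\frac{\partial \bm{u}}{\partial t}+\sum_{m=1}^d \frac{\partial \bm{f}_m(\bm{u})}{\partial x_m}=0$ with $\bm{u}(\bm{x},t)\in\mathbb{R}^n$. $S(\bm{u})$ is a scalar convex entropy with entropy variables $\bm{v}(\bm{u})=\partial S/\partial\bm{u}$; the map $\bm{u}\mapsto\bm{v}(\bm{u})$ is invertible, with inverse denoted $\bm{v}\mapsto\bm{u}(\bm{v})$. $\psi_m$ ($m=1,\dots,d$) are the scalar entropy potentials. The domain $\Omega\subset\mathbb{R}^d$ is triangulated by non-overlapping simplicial elements $D^k$; $\bm{n}=(n_1,\dots,n_d)$ is the outward unit normal on $\partial D^k$ (or on $\partial\Omega$). Every face not on $\partial\Omega$ is shared by exactly two elements. On a face of $D^k$, $\tilde{\bm{u}}$ denotes the interior value and $\tilde{\bm{u}}^+$ the exterior value (the value from the neighboring element, or a prescribed exterior state on $\partial\Omega$). $P^N(D^k)$ is the space of polynomials of total degree at most $N$, and $\bm{u}_h(\cdot,t)|_{D^k}\in[P^N(D^k)]^n$ is differentiable in time. $(u,v)_{D^k}\approx\int_{D^k}uv$ and $\langle u,v\rangle_{\partial D^k}\approx\int_{\partial D^k}uv$ denote $L^2$ inner products evaluated with fixed volume and surface quadrature rules (possibly inexact), where surface quadrature weights are positive and the two elements sharing a face use the same quadrature on it; $(\cdot,\cdot)_\Omega=\sum_k(\cdot,\cdot)_{D^k}$, and $\langle\cdot,\cdot\rangle_{\partial\Omega}$ is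 the sum of the surface quadratures over faces lying on $\partial\Omega$. $\Pi_N$ is the (componentwise) $L^2$ projection onto $P^N(D^k)$ with respect to the discrete inner product: $(\Pi_N f,v)_{D^k}=(f,v)_{D^k}$ for all $v\in P^N(D^k)$ (assumed well defined). *)

theory Defs
  imports "HOL-Analysis.Analysis"
begin

(* Elements may meet in hanging lower-dimensional faces; only faces of codimension one (facets)
   carry surface terms, and conformity is required of those that do not lie on the boundary. *)
definition simplicial_mesh :: "(real^'d) set \<Rightarrow> (real^'d) set set \<Rightarrow> bool" where
  "simplicial_mesh \<Omega> \<T> \<longleftrightarrow>
     open \<Omega> \<and> finite \<T> \<and> closure \<Omega> = \<Union>\<T> \<and>
     (\<forall>T\<in>\<T>. int CARD('d) simplex T) \<and>
     pairwise (\<lambda>T T'. interior T \<inter> interior T' = {}) \<T> \<and>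
     (\<forall>T\<in>\<T>. \<forall>F. F facet_of T \<and> \<not> F \<subseteq> frontier \<Omega> \<longrightarrow> card {T' \<in> \<T>. F facet_of T'} = 2)"

definition outward_normal :: "(real^'d) set \<Rightarrow> (real^'d) set \<Rightarrow> real^'d" where
  "outward_normal T F =
     (THE n. norm n = 1 \<and> (\<exists>b. T \<subseteq> {x. n \<bullet> x \<le> b} \<and> F = T \<inter> {x. n \<bullet> x = b}))"

definition neighbor :: "(real^'d) set set \<Rightarrow> (real^'d) set \<Rightarrow> (real^'d) set \<Rightarrow> (real^'d) set" where
  "neighbor \<T> T F = (THE T'. T' \<in> \<T> \<and> T' \<noteq> T \<and> F facet_of T')"

(* An elementwise function w T need not agree with w T' where T and T' meet. Prescribed boundary
   states g may depend on the face, since the boundary normal does. *)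
definition exterior_value ::
  "(real^'d) set \<Rightarrow> (real^'d) set set \<Rightarrow>
   ((real^'d) set \<Rightarrow> (real^'d) set \<Rightarrow> real^'d \<Rightarrow> real^'n) \<Rightarrow>
   ((real^'d) set \<Rightarrow> real^'d \<Rightarrow> real^'n) \<Rightarrow>
   (real^'d) set \<Rightarrow> (real^'d) set \<Rightarrow> real^'d \<Rightarrow> real^'n" where
  "exterior_value \<Omega> \<T> g w T F x =
     (if F \<subseteq> frontier \<Omega> then g T F x else w (neighbor \<T> T F) x)"

(* Polynomial functions of total degree at most N, on the whole space; a simplex of full
   dimension has nonempty interior, so restriction to an element is injective. *)
definition poly_space :: "nat \<Rightarrow> (real^'d \<Rightarrow> real) set" where
  "poly_space N =
     {p. \<exists>c :: ('d \<Rightarrow> nat) \<Rightarrow> real.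
           \<forall>x. p x = (\<Sum>\<alpha> | (\<Sum>i\<in>UNIV. \<alpha> i) \<le> N. c \<alpha> * (\<Prod>i\<in>UNIV. (x $ i) ^ \<alpha> i))}"

definition quad_inner :: "'a set \<Rightarrow> ('a \<Rightarrow> real) \<Rightarrow> ('a \<Rightarrow> real) \<Rightarrow> ('a \<Rightarrow> real) \<Rightarrow> real" where
  "quad_inner X w f g = (\<Sum>x\<in>X. w x * (f x * g x))"

definition domain_inner ::
  "(real^'d) set set \<Rightarrow> ((real^'d) set \<Rightarrow> (real^'d) set) \<Rightarrow> ((real^'d) set \<Rightarrow> real^'d \<Rightarrow> real) \<Rightarrow>
   ((real^'d) set \<Rightarrow> real^'d \<Rightarrow> real) \<Rightarrow> ((real^'d) set \<Rightarrow> real^'d \<Rightarrow> real) \<Rightarrow> real" where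
  "domain_inner \<T> X w f g = (\<Sum>T\<in>\<T>. quad_inner (X T) (w T) (f T) (g T))"

(* Surface quadratures are indexed by the face, so that two elements sharing a face use the
   same one. Integrands depend on the face as well, through the normal. *)
definition elem_bd_inner ::
  "((real^'d) set \<Rightarrow> (real^'d) set) \<Rightarrow> ((real^'d) set \<Rightarrow> real^'d \<Rightarrow> real) \<Rightarrow> (real^'d) set \<Rightarrow>
   ((real^'d) set \<Rightarrow> real^'d \<Rightarrow> real) \<Rightarrow> ((real^'d) set \<Rightarrow> real^'d \<Rightarrow> real) \<Rightarrow> real" where
  "elem_bd_inner X w T f g = (\<Sum>F | F facet_of T. quad_inner (X F) (w F) (f F) (g F))"

(* Integrands are those seen from the element T to which the boundary face belongs. *)
definition domain_bd_inner ::
  "(real^'d) set \<Rightarrow> (real^'d) set set \<Rightarrow>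
   ((real^'d) set \<Rightarrow> (real^'d) set) \<Rightarrow> ((real^'d) set \<Rightarrow> real^'d \<Rightarrow> real) \<Rightarrow>
   ((real^'d) set \<Rightarrow> (real^'d) set \<Rightarrow> real^'d \<Rightarrow> real) \<Rightarrow>
   ((real^'d) set \<Rightarrow> (real^'d) set \<Rightarrow> real^'d \<Rightarrow> real) \<Rightarrow> real" where
  "domain_bd_inner \<Omega> \<T> X w f g =
     (\<Sum>T\<in>\<T>. \<Sum>F | F facet_of T \<and> F \<subseteq> frontier \<Omega>. quad_inner (X F) (w F) (f T F) (g T F))"

definition is_L2_proj ::
  "nat \<Rightarrow> (real^'d) set \<Rightarrow> (real^'d \<Rightarrow> real) \<Rightarrow> (real^'d \<Rightarrow> real) \<Rightarrow> (real^'d \<Rightarrow> real) \<Rightarrow> bool" where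
  "is_L2_proj N X w f p \<longleftrightarrow>
     p \<in> poly_space N \<and> (\<forall>q\<in>poly_space N. quad_inner X w p q = quad_inner X w f q)"

definition L2_proj ::
  "nat \<Rightarrow> (real^'d) set \<Rightarrow> (real^'d \<Rightarrow> real) \<Rightarrow> (real^'d \<Rightarrow> real) \<Rightarrow> real^'d \<Rightarrow> real" where
  "L2_proj N X w f = (THE p. is_L2_proj N X w f p)"

definition L2_proj_vec ::
  "nat \<Rightarrow> (real^'d) set \<Rightarrow> (real^'d \<Rightarrow> real) \<Rightarrow> (real^'d \<Rightarrow> real^'n) \<Rightarrow> real^'d \<Rightarrow> real^'n" where
  "L2_proj_vec N X w f x = (\<chi> i. L2_proj N X w (\<lambda>y. f y $ i) x)"

(* F is an entropy flux for the flux f and entropy variables v: its gradient is the transposed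
   Jacobian of f applied to v. *)
definition entropy_flux ::
  "(real^'n) set \<Rightarrow> (real^'n \<Rightarrow> real^'n) \<Rightarrow> (real^'n \<Rightarrow> real^'n) \<Rightarrow> (real^'n \<Rightarrow> real) \<Rightarrow> bool" where
  "entropy_flux U v f F \<longleftrightarrow>
     (\<forall>u\<in>U. \<exists>A. (f has_derivative A) (at u) \<and> (F has_derivative (\<lambda>h. v u \<bullet> A h)) (at u))"

definition entropy_potential ::
  "(real^'n \<Rightarrow> real^'n) \<Rightarrow> (real^'n \<Rightarrow> real^'n) \<Rightarrow> (real^'n \<Rightarrow> real) \<Rightarrow> real^'n \<Rightarrow> real" where
  "entropy_potential v f F u = v u \<bullet> f u - F u"

definition skew_symmetric_flux ::
  "(real^'n) set \<Rightarrow> (real^'d \<Rightarrow> real^'n \<Rightarrow> real^'n \<Rightarrow> real^'n) \<Rightarrow> bool" where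
  "skew_symmetric_flux U fstar \<longleftrightarrow>
     (\<forall>uL\<in>U. \<forall>uR\<in>U. \<forall>n. norm n = 1 \<longrightarrow> fstar n uL uR = - fstar (- n) uR uL)"

definition entropy_stable_flux ::
  "(real^'n) set \<Rightarrow> (real^'n \<Rightarrow> real^'n) \<Rightarrow> ('d::finite \<Rightarrow> real^'n \<Rightarrow> real) \<Rightarrow>
   (real^'d \<Rightarrow> real^'n \<Rightarrow> real^'n \<Rightarrow> real^'n) \<Rightarrow> bool" where
  "entropy_stable_flux U v \<psi> fstar \<longleftrightarrow>
     (\<forall>uL\<in>U. \<forall>uR\<in>U. \<forall>n. norm n = 1 \<longrightarrow>
        (v uL - v uR) \<bullet> fstar n uL uR \<le> (\<Sum>m\<in>UNIV. (\<psi> m uL - \<psi> m uR) * n $ m))"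

end

theory Submission
  imports Defs
begin

text \<open>
  Split the surface terms of all elements into those on boundary faces and those on interior faces.
  An interior face is a facet of exactly two elements, whose outward normals there are opposite.
  By skew-symmetry of the interface flux, its two surface terms add up to the amount by which
  entropy stability holds, which is nonnegative; positive quadrature weights preserve the sign.
  So discarding the interior faces does not increase the sum.
\<close>

section \<open>Facets and their outward unit normals\<close>

lemma unit_hyperplane_eq_cases:
  fixes n n' :: "'a::euclidean_space"
  assumes "norm n = 1" "norm n' = 1" and eq: "{x. n \<bullet> x = b} = {x. n' \<bullet> x = b'}"
  shows "n' = n \<and> b' = b \<or> n' = - n \<and> b' = - b"
proof -
  have nn: "n \<bullet> n = 1"
    using assms(1) by (simp add: dot_square_norm)
  \<comment> \<open>This is the foot of the perpendicular from the origin; inserting it into the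
    second equation expresses \<open>b'\<close> through the cosine
    \<open>n' \<bullet> n\<close>.\<close>
  have "b *\<^sub>R n \<in> {x. n \<bullet> x = b}"
    by (simp add: nn)
  then have b': "b' = (n' \<bullet> n) * b"
    unfolding eq by (simp add: mult.commute)
  have "n' \<bullet> x = ((n' \<bullet> n) *\<^sub>R n) \<bullet> x" for x
  proof -
    \<comment> \<open>The orthogonal projection of \<open>x\<close> onto the hyperplane. The terms
      with \<open>b\<close> cancel against \<open>b'\<close>, so \<open>n'\<close> acts on
      \<open>x\<close> only through \<open>n \<bullet> x\<close>.\<close>
    have "x - (n \<bullet> x) *\<^sub>R n + b *\<^sub>R n \<in> {x. n \<bullet> x = b}"
      by (simp add: nn inner_simps)
    then have "n' \<bullet> (x - (n \<bullet> x) *\<^sub>R n + b *\<^sub>R n) = b'"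
      unfolding eq by simp
    then show ?thesis
      using b' by (simp add: inner_simps)
  qed
  then have n': "n' = (n' \<bullet> n) *\<^sub>R n"
    using vector_eq_rdot by blast
  then have "norm n' = \<bar>n' \<bullet> n\<bar>"
    using assms(1) by (metis mult.right_neutral norm_scaleR)
  then have "n' \<bullet> n = 1 \<or> n' \<bullet> n = - 1"
    using assms(2) by linarith
  then show ?thesis
    using b' n' by auto
qed

text \<open>\<open>E\<close> lies in the hyperplane and has the same dimension, since
  \<open>T\<close> is full-dimensional. Hence the hyperplane depends on \<open>E\<close> alone, and
  any two supporting descriptions of \<open>E\<close>, even from different elements, give the same
  one.\<close>

lemma affine_hull_facet:
  fixes T :: "'a::euclidean_space set"
  assumes "interior T \<noteq> {}" "E facet_of T" "a \<noteq> 0" and E: "E = T \<inter> {x. a \<bullet> x = b}"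
  shows "affine hull E = {x. a \<bullet> x = b}"
proof -
  have "aff_dim E = aff_dim {x. a \<bullet> x = b}"
    using assms by (simp add: facet_of_def aff_dim_nonempty_interior of_nat_diff Suc_leI)
  then have "affine hull E = affine hull {x. a \<bullet> x = b}"
    using aff_dim_eq_full_gen[of E "{x. a \<bullet> x = b}"] E by blast
  then show ?thesis
    by (simp add: affine_hyperplane affine_hull_eq)
qed

lemma interior_halfspace_less:
  fixes T :: "'a::euclidean_space set"
  assumes "T \<subseteq> {x. a \<bullet> x \<le> b}" "a \<noteq> 0" "z \<in> interior T"
  shows "a \<bullet> z < b"
  using interior_mono[OF assms(1)] assms(2,3) by auto

lemma facet_unit_normal_exists:
  fixes T :: "'a::euclidean_space set"
  assumes "polyhedron T" "E facet_of T"
  obtains n b where "norm n = 1" "T \<subseteq> {x. n \<bullet> x \<le> b}" "E = T \<inter> {x. n \<bullet> x = b}"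
proof -
  have "E exposed_face_of T" "E \<noteq> {}" "E \<noteq> T"
    using assms by (auto simp: exposed_face_of_polyhedron facet_of_def)
  then obtain a b where a: "a \<noteq> 0" "T \<subseteq> {x. a \<bullet> x \<le> b}" "E = T \<inter> {x. a \<bullet> x = b}"
    unfolding exposed_face_of by blast
  show thesis
  proof (rule that[of "a /\<^sub>R norm a" "b / norm a"])
    show "norm (a /\<^sub>R norm a) = 1"
      using a(1) by simp
    show "T \<subseteq> {x. (a /\<^sub>R norm a) \<bullet> x \<le> b / norm a}"
      using a(1,2) by (auto simp: divide_simps)
    show "E = T \<inter> {x. (a /\<^sub>R norm a) \<bullet> x = b / norm a}"
      using a(1,3) by (auto simp: divide_simps)
  qed
qed

text \<open>Justifies the definite description in \<open>outward_normal\<close>: two candidates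
  define the same hyperplane, the affine hull of \<open>E\<close>, so they agree up to sign, and an
  interior point of \<open>T\<close> decides the sign.\<close>

lemma outward_normal_props:
  fixes T :: "(real^'d) set"
  assumes "polyhedron T" "interior T \<noteq> {}" "E facet_of T"
  shows "norm (outward_normal T E) = 1
    \<and> (\<exists>b. T \<subseteq> {x. outward_normal T E \<bullet> x \<le> b} \<and> E = T \<inter> {x. outward_normal T E \<bullet> x = b})"
proof -
  let ?P = "\<lambda>n. norm n = 1 \<and> (\<exists>b. T \<subseteq> {x. n \<bullet> x \<le> b} \<and> E = T \<inter> {x. n \<bullet> x = b})"
  have "\<exists>!n. ?P n"
  proof (rule ex_ex1I)
    show "\<exists>n. ?P n"
      using facet_unit_normal_exists[OF assms(1,3)] by metis
    fix n n' assume "?P n" "?P n'"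
    then obtain b b' where n: "norm n = 1" "T \<subseteq> {x. n \<bullet> x \<le> b}" "E = T \<inter> {x. n \<bullet> x = b}"
      and n': "norm n' = 1" "T \<subseteq> {x. n' \<bullet> x \<le> b'}" "E = T \<inter> {x. n' \<bullet> x = b'}"
      by blast
    have nz: "n \<noteq> 0" "n' \<noteq> 0"
      using n(1) n'(1) by auto
    have "{x. n \<bullet> x = b} = {x. n' \<bullet> x = b'}"
      using affine_hull_facet[OF assms(2,3)] nz n(3) n'(3) by metis
    then have "n' = n \<and> b' = b \<or> n' = - n \<and> b' = - b"
      by (rule unit_hyperplane_eq_cases[OF n(1) n'(1)])
    moreover obtain z where "z \<in> interior T"
      using assms(2) by blast
    then have "n \<bullet> z < b" "n' \<bullet> z < b'"
      using interior_halfspace_less n(2) n'(2) nz by blast+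
    ultimately show "n = n'"
      by auto
  qed
  then show ?thesis
    unfolding outward_normal_def by (rule theI')
qed

text \<open>Just below the relative interior of \<open>E\<close>, both sets fill the same side of
  the hyperplane. A common interior point is reached from two nearby points of \<open>E\<close>:
  from \<open>p\<close> towards \<open>z\<close> in \<open>T\<close>, and from \<open>q\<close>
  towards \<open>z'\<close> in \<open>T'\<close>.\<close>

lemma same_side_facet_interiors_meet:
  fixes T T' :: "'a::euclidean_space set"
  assumes "convex T" "convex T'" "interior T \<noteq> {}" "interior T' \<noteq> {}"
    and facet: "E facet_of T" "E \<subseteq> T'" and "a \<noteq> 0"
    and T: "T \<subseteq> {x. a \<bullet> x \<le> b}" "E = T \<inter> {x. a \<bullet> x = b}" and T': "T' \<subseteq> {x. a \<bullet> x \<le> b}"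
  shows "interior T \<inter> interior T' \<noteq> {}"
proof -
  have hull: "affine hull E = {x. a \<bullet> x = b}"
    by (rule affine_hull_facet[OF assms(3) facet(1) \<open>a \<noteq> 0\<close> T(2)])
  have "convex E" "E \<noteq> {}"
    using facet(1) assms(1) by (auto simp: facet_of_def face_of_imp_convex)
  then obtain p where "p \<in> rel_interior E"
    using rel_interior_eq_empty by blast
  then obtain e where p: "p \<in> E" and e: "e > 0" "ball p e \<inter> affine hull E \<subseteq> E"
    unfolding mem_rel_interior_ball by blast
  have ap: "a \<bullet> p = b"
    using p T(2) by blast
  obtain z z' where z: "z \<in> interior T" and z': "z' \<in> interior T'"
    using assms(3,4) by blast
  have lt: "a \<bullet> z < b" "a \<bullet> z' < b"
    using interior_halfspace_less T(1) T' \<open>a \<noteq> 0\<close> z z' by blast+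
  \<comment> \<open>The ratio of the distances of \<open>z\<close> and \<open>z'\<close> from the
    hyperplane: moving by the fraction \<open>r\<close> towards \<open>z\<close> or by
    \<open>r * \<alpha>\<close> towards \<open>z'\<close> leaves the hyperplane equally far.\<close>
  define \<alpha> where "\<alpha> = (b - a \<bullet> z) / (b - a \<bullet> z')"
  have \<alpha>: "\<alpha> > 0"
    using lt by (simp add: \<alpha>_def)
  \<comment> \<open>The directions from \<^term>\<open>p\<close> into the two sets differ, up to scaling, by a vector
    \<^term>\<open>h\<close> parallel to the hyperplane.\<close>
  define h where "h = (z - p) - \<alpha> *\<^sub>R (z' - p)"
  have ah: "a \<bullet> h = 0"
    using lt ap by (simp add: h_def \<alpha>_def inner_simps field_simps)
  \<comment> \<open>For small positive \<open>r\<close>, both \<open>r\<close> and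
    \<open>r * \<alpha>\<close> are admissible convex weights, and the point \<open>q\<close> below
    stays in the ball around \<open>p\<close> where the hyperplane is contained in
    \<open>E\<close>.\<close>
  have "\<forall>\<^sub>F r in at_right 0. r * \<alpha> < 1"
    by (rule order_tendstoD) (auto intro!: tendsto_eq_intros)
  moreover have "\<forall>\<^sub>F r in at_right 0. dist (p + (r / (1 - r * \<alpha>)) *\<^sub>R h) p < e"
    by (rule tendstoD[OF _ e(1)]) (auto intro!: tendsto_eq_intros)
  moreover have "\<forall>\<^sub>F r in at_right 0. r < (1::real)"
    by (rule order_tendstoD) (auto intro!: tendsto_eq_intros)
  moreover have "\<forall>\<^sub>F r in at_right 0. (0::real) < r"
    by (rule eventually_at_right_less)
  ultimately have "\<forall>\<^sub>F r in at_right (0::real).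
      r * \<alpha> < 1 \<and> dist (p + (r / (1 - r * \<alpha>)) *\<^sub>R h) p < e \<and> r < 1 \<and> 0 < r"
    by eventually_elim simp
  then obtain r where r: "r * \<alpha> < 1" "dist (p + (r / (1 - r * \<alpha>)) *\<^sub>R h) p < e" "r < 1" "0 < r"
    using eventually_happens trivial_limit_at_right_real by blast
  \<comment> \<open>The solution of
    \<open>(1 - r * \<alpha>) q + r * \<alpha> z' = (1 - r) p + r z\<close>, which makes the two
    paths end at the same point.\<close>
  define q where "q = p + (r / (1 - r * \<alpha>)) *\<^sub>R h"
  have "q \<in> E"
    using e(2) r(2) ap ah by (auto simp: hull q_def dist_commute inner_simps)
  then have "q - (r * \<alpha>) *\<^sub>R (q - z') \<in> interior T'"
    using mem_interior_convex_shrink[OF assms(2) z', of q "r * \<alpha>"] facet(2) r(1,4) \<alpha> by auto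
  moreover have "p - r *\<^sub>R (p - z) \<in> interior T"
    using mem_interior_convex_shrink[OF assms(1) z, of p r] p T(2) r(3,4) by auto
  moreover have "q - (r * \<alpha>) *\<^sub>R (q - z') = p - r *\<^sub>R (p - z)"
  proof -
    have "q - (r * \<alpha>) *\<^sub>R (q - z') = (1 - r * \<alpha>) *\<^sub>R q + (r * \<alpha>) *\<^sub>R z'"
      by (simp add: algebra_simps)
    also have "(1 - r * \<alpha>) *\<^sub>R q = (1 - r * \<alpha>) *\<^sub>R p + r *\<^sub>R h"
      using r(1) by (simp add: q_def scaleR_add_right)
    finally show ?thesis
      by (simp add: h_def algebra_simps)
  qed
  ultimately show ?thesis
    by (metis disjoint_iff)
qed

text \<open>Both normals belong to the affine hull of \<open>E\<close>, so they agree up to sign;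
  equal signs would put both elements on the same side and force their interiors to meet.\<close>

lemma outward_normal_opposite:
  fixes T T' :: "(real^'d) set"
  assumes "polyhedron T" "polyhedron T'" and int: "interior T \<noteq> {}" "interior T' \<noteq> {}"
    and facet: "E facet_of T" "E facet_of T'" and disj: "interior T \<inter> interior T' = {}"
  shows "outward_normal T' E = - outward_normal T E"
proof -
  let ?n = "outward_normal T E" and ?n' = "outward_normal T' E"
  obtain b b' where n: "norm ?n = 1" "T \<subseteq> {x. ?n \<bullet> x \<le> b}" "E = T \<inter> {x. ?n \<bullet> x = b}"
    and n': "norm ?n' = 1" "T' \<subseteq> {x. ?n' \<bullet> x \<le> b'}" "E = T' \<inter> {x. ?n' \<bullet> x = b'}"
    using outward_normal_props[OF assms(1) int(1) facet(1)]
      outward_normal_props[OF assms(2) int(2) facet(2)] by blast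
  have nz: "?n \<noteq> 0" "?n' \<noteq> 0"
    using n(1) n'(1) by auto
  have "{x. ?n \<bullet> x = b} = {x. ?n' \<bullet> x = b'}"
    using affine_hull_facet[OF int(1) facet(1) nz(1) n(3)]
      affine_hull_facet[OF int(2) facet(2) nz(2) n'(3)] by simp
  then have cases: "?n' = ?n \<and> b' = b \<or> ?n' = - ?n \<and> b' = - b"
    by (rule unit_hyperplane_eq_cases[OF n(1) n'(1)])
  have "\<not> (?n' = ?n \<and> b' = b)"
  proof
    assume "?n' = ?n \<and> b' = b"
    then have "T' \<subseteq> {x. ?n \<bullet> x \<le> b}"
      using n'(2) by simp
    from same_side_facet_interiors_meet[OF polyhedron_imp_convex polyhedron_imp_convex int
        facet(1) facet_of_imp_subset[OF facet(2)] nz(1) n(2,3) this] assms(1,2) disj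
    show False
      by simp
  qed
  with cases show ?thesis
    by blast
qed

section \<open>Pairing the two sides of each interior face\<close>

lemma sum_interior_facets_nonneg:
  fixes \<Omega> :: "(real^'d) set" and h :: "(real^'d) set \<Rightarrow> (real^'d) set \<Rightarrow> real"
  assumes mesh: "simplicial_mesh \<Omega> \<T>"
    and pair: "\<And>T T' E. \<lbrakk>T \<in> \<T>; T' \<in> \<T>; T \<noteq> T'; E facet_of T; E facet_of T'; \<not> E \<subseteq> frontier \<Omega>;
        neighbor \<T> T E = T'; neighbor \<T> T' E = T\<rbrakk> \<Longrightarrow> 0 \<le> h T E + h T' E"
  shows "0 \<le> (\<Sum>T\<in>\<T>. \<Sum>E | E facet_of T \<and> \<not> E \<subseteq> frontier \<Omega>. h T E)"
proof -
  have fin: "finite {E. E facet_of T}" if "T \<in> \<T>" for T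
    using mesh that finite_polytope_facets[OF simplex_imp_polytope, of "int CARD('d)" T]
    by (simp add: simplicial_mesh_def)
  have fin\<T>: "finite \<T>"
    using mesh by (simp add: simplicial_mesh_def)
  define B where "B = (\<Union>T\<in>\<T>. {E. E facet_of T \<and> \<not> E \<subseteq> frontier \<Omega>})"
  have finB: "finite B"
    unfolding B_def by (intro finite_UN_I fin\<T> finite_subset[OF _ fin]) auto
  have "(\<Sum>T\<in>\<T>. \<Sum>E | E facet_of T \<and> \<not> E \<subseteq> frontier \<Omega>. h T E)
      = (\<Sum>T\<in>\<T>. \<Sum>E | E \<in> B \<and> E facet_of T. h T E)"
    by (intro sum.cong refl) (auto simp: B_def)
  \<comment> \<open>Summing face by face instead of element by element brings together the
    contributions of the elements sharing a face.\<close>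
  also have "\<dots> = (\<Sum>E\<in>B. \<Sum>T | T \<in> \<T> \<and> E facet_of T. h T E)"
    by (rule sum.swap_restrict[OF fin\<T> finB])
  also have "\<dots> \<ge> 0"
  proof (rule sum_nonneg)
    fix E assume "E \<in> B"
    then obtain K where K: "K \<in> \<T>" "E facet_of K" and E: "\<not> E \<subseteq> frontier \<Omega>"
      unfolding B_def by blast
    have "card {T \<in> \<T>. E facet_of T} = 2"
      using mesh K E unfolding simplicial_mesh_def by blast
    then obtain T T' where TT: "{T \<in> \<T>. E facet_of T} = {T, T'}" "T \<noteq> T'"
      unfolding card_2_iff by blast
    then have mem: "T \<in> \<T>" "T' \<in> \<T>" "E facet_of T" "E facet_of T'"
      by blast+
    have "neighbor \<T> T E = T'" "neighbor \<T> T' E = T"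
      unfolding neighbor_def by (rule the_equality; use TT mem in blast)+
    then show "0 \<le> (\<Sum>T | T \<in> \<T> \<and> E facet_of T. h T E)"
      unfolding TT(1) using pair[OF mem(1,2) TT(2) mem(3,4) E] TT(2) by simp
  qed
  finally show ?thesis .
qed

text \<open>By skew-symmetry both sides see the same flux up to sign, so the sum is the right side
  minus the left side of the stability inequality with \<open>u'\<close> as left state and
  \<open>u\<close> as right state.\<close>

lemma interface_production_nonneg:
  fixes fstar :: "real^'d \<Rightarrow> real^'n \<Rightarrow> real^'n \<Rightarrow> real^'n"
  assumes skew: "skew_symmetric_flux U fstar" and stable: "entropy_stable_flux U v \<psi> fstar"
    and u: "u \<in> U" "u' \<in> U" and n: "norm n = 1"
  shows "0 \<le> (v u \<bullet> fstar n u' u - (\<Sum>m\<in>UNIV. \<psi> m u * n $ m))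
    + (v u' \<bullet> fstar (- n) u u' - (\<Sum>m\<in>UNIV. \<psi> m u' * (- n) $ m))"
proof -
  have "fstar (- n) u u' = - fstar n u' u"
    using skew u n unfolding skew_symmetric_flux_def by (metis minus_minus)
  moreover have "(v u' - v u) \<bullet> fstar n u' u \<le> (\<Sum>m\<in>UNIV. (\<psi> m u' - \<psi> m u) * n $ m)"
    using stable u n unfolding entropy_stable_flux_def by blast
  ultimately show ?thesis
    by (simp add: inner_simps left_diff_distrib sum_subtractf sum_negf)
qed

section \<open>The global entropy inequality\<close>

theorem lemma3:
  fixes \<Omega> :: "(real^'d) set" and \<T> :: "(real^'d) set set"
    and U :: "(real^'n) set" and S :: "real^'n \<Rightarrow> real" and v :: "real^'n \<Rightarrow> real^'n"
    and f :: "'d \<Rightarrow> real^'n \<Rightarrow> real^'n" and F :: "'d \<Rightarrow> real^'n \<Rightarrow> real"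
    and \<psi> :: "'d \<Rightarrow> real^'n \<Rightarrow> real"
    and fstar :: "real^'d \<Rightarrow> real^'n \<Rightarrow> real^'n \<Rightarrow> real^'n"
    and N :: nat
    and X\<^sub>v X\<^sub>s :: "(real^'d) set \<Rightarrow> (real^'d) set"
    and w\<^sub>v w\<^sub>s :: "(real^'d) set \<Rightarrow> real^'d \<Rightarrow> real"
    and I :: "real set" and t :: real
    and u\<^sub>h :: "(real^'d) set \<Rightarrow> real \<Rightarrow> real^'d \<Rightarrow> real^'n"
    and u\<^sub>b :: "(real^'d) set \<Rightarrow> (real^'d) set \<Rightarrow> real^'d \<Rightarrow> real^'n"
    and v\<^sub>h ut :: "(real^'d) set \<Rightarrow> real^'d \<Rightarrow> real^'n"
    and dSdt :: "(real^'d) set \<Rightarrow> real^'d \<Rightarrow> real"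
    and flux :: "(real^'d) set \<Rightarrow> (real^'d) set \<Rightarrow> real^'d \<Rightarrow> real^'n"
    and G :: "(real^'d) set \<Rightarrow> (real^'d) set \<Rightarrow> real^'d \<Rightarrow> real"
  assumes mesh: "simplicial_mesh \<Omega> \<T>"
    and vol_quad: "\<And>T. T \<in> \<T> \<Longrightarrow> finite (X\<^sub>v T) \<and> X\<^sub>v T \<subseteq> T"
    and surf_quad: "\<And>T E. T \<in> \<T> \<Longrightarrow> E facet_of T \<Longrightarrow>
                      finite (X\<^sub>s E) \<and> X\<^sub>s E \<subseteq> E \<and> (\<forall>x\<in>X\<^sub>s E. w\<^sub>s E x > 0)"
    and proj_well_defined: "\<And>T g. T \<in> \<T> \<Longrightarrow> \<exists>!p. is_L2_proj N (X\<^sub>v T) (w\<^sub>v T) g p"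
    and states: "open U" "convex_on U S"
    and entropy_vars: "\<And>u. u \<in> U \<Longrightarrow> GDERIV S u :> v u" "inj_on v U"
    and potentials: "\<And>m. entropy_flux U v (f m) (F m)"
                    "\<And>m. \<psi> m = entropy_potential v (f m) (F m)"
    and interface_flux: "skew_symmetric_flux U fstar" "entropy_stable_flux U v \<psi> fstar"
    and time: "open I" "t \<in> I"
    and u\<^sub>h_poly: "\<And>T s i. T \<in> \<T> \<Longrightarrow> s \<in> I \<Longrightarrow> (\<lambda>x. u\<^sub>h T s x $ i) \<in> poly_space N"
    and u\<^sub>h_diff: "\<And>T s x. T \<in> \<T> \<Longrightarrow> s \<in> I \<Longrightarrow> x \<in> T \<Longrightarrow> (\<lambda>r. u\<^sub>h T r x) differentiable (at s)"
    and u\<^sub>h_state: "\<And>T s x. T \<in> \<T> \<Longrightarrow> s \<in> I \<Longrightarrow> x \<in> X\<^sub>v T \<Longrightarrow> u\<^sub>h T s x \<in> U"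
    and v\<^sub>h: "v\<^sub>h = (\<lambda>T. L2_proj_vec N (X\<^sub>v T) (w\<^sub>v T) (\<lambda>x. v (u\<^sub>h T t x)))"
    and v\<^sub>h_range: "\<And>T E x. T \<in> \<T> \<Longrightarrow> E facet_of T \<Longrightarrow> x \<in> X\<^sub>s E \<Longrightarrow> v\<^sub>h T x \<in> v ` U"
    and ut: "ut = (\<lambda>T x. inv_into U v (v\<^sub>h T x))"
    and u\<^sub>b_state: "\<And>T E x. T \<in> \<T> \<Longrightarrow> E facet_of T \<Longrightarrow> E \<subseteq> frontier \<Omega> \<Longrightarrow> x \<in> X\<^sub>s E \<Longrightarrow> u\<^sub>b T E x \<in> U"
    and flux: "flux = (\<lambda>T E x. fstar (outward_normal T E)
                                 (exterior_value \<Omega> \<T> u\<^sub>b ut T E x) (ut T x))"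
    and dSdt: "dSdt = (\<lambda>T x. deriv (\<lambda>s. S (u\<^sub>h T s x)) t)"
    and G: "G = (\<lambda>T E x. v\<^sub>h T x \<bullet> flux T E x
                          - (\<Sum>m\<in>UNIV. \<psi> m (ut T x) * outward_normal T E $ m))"
    and local_ineq: "(\<Sum>T\<in>\<T>. quad_inner (X\<^sub>v T) (w\<^sub>v T) (dSdt T) (\<lambda>x. 1)
                             + elem_bd_inner X\<^sub>s w\<^sub>s T (G T) (\<lambda>E x. 1)) \<le> 0"
  shows "domain_inner \<T> X\<^sub>v w\<^sub>v dSdt (\<lambda>T x. 1)
           + domain_bd_inner \<Omega> \<T> X\<^sub>s w\<^sub>s G (\<lambda>T E x. 1) \<le> 0"
proof -
  have simp\<T>: "polyhedron T" "interior T \<noteq> {}" "finite {E. E facet_of T}" if "T \<in> \<T>" for T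
  proof -
    have "int CARD('d) simplex T"
      using mesh that by (simp add: simplicial_mesh_def)
    \<comment> \<open>A simplex of dimension \<open>CARD('d)\<close> spans the whole space, so its
      interior is its relative interior, which is nonempty.\<close>
    moreover from this have "rel_interior T = interior T" "T \<noteq> {}"
      using aff_dim_eq_full[of T] rel_interior_interior[of T] by (auto dest: aff_dim_simplex)
    ultimately show "polyhedron T" "interior T \<noteq> {}" "finite {E. E facet_of T}"
      using rel_interior_eq_empty[of T] convex_simplex
      by (auto intro: simplex_imp_polyhedron finite_polytope_facets simplex_imp_polytope)
  qed
  define h where "h = (\<lambda>T E. quad_inner (X\<^sub>s E) (w\<^sub>s E) (G T E) (\<lambda>x. 1))"
  have interior: "0 \<le> (\<Sum>T\<in>\<T>. \<Sum>E | E facet_of T \<and> \<not> E \<subseteq> frontier \<Omega>. h T E)"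
  proof (rule sum_interior_facets_nonneg[OF mesh])
    fix T T' E
    assume T: "T \<in> \<T>" "T' \<in> \<T>" "T \<noteq> T'" and E: "E facet_of T" "E facet_of T'" "\<not> E \<subseteq> frontier \<Omega>"
      and nb: "neighbor \<T> T E = T'" "neighbor \<T> T' E = T"
    have "interior T \<inter> interior T' = {}"
      using mesh T unfolding simplicial_mesh_def pairwise_def by blast
    then have opp: "outward_normal T' E = - outward_normal T E"
      using outward_normal_opposite[of T T' E] simp\<T> T E by blast
    have unit: "norm (outward_normal T E) = 1"
      using outward_normal_props[OF simp\<T>(1,2)[OF T(1)] E(1)] by simp
    have pointwise: "0 \<le> G T E x + G T' E x" if x: "x \<in> X\<^sub>s E" for x
    proof -
      \<comment> \<open>Here the entropy projection enters: the projected entropy variables are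
        exactly the entropy variables of the states \<open>ut\<close> at which the flux is
        evaluated.\<close>
      have inv: "ut K x \<in> U \<and> v (ut K x) = v\<^sub>h K x" if "K \<in> \<T>" "E facet_of K" for K
        using v\<^sub>h_range[OF that x] by (simp add: ut inv_into_into f_inv_into_f)
      show ?thesis
        using interface_production_nonneg[OF interface_flux _ _ unit, of "ut T x" "ut T' x"]
          inv[OF T(1) E(1)] inv[OF T(2) E(2)]
        by (simp add: G flux exterior_value_def E(3) nb opp)
    qed
    \<comment> \<open>Both elements use the nodes and weights attached to \<open>E\<close>, so the
      two quadratures merge into one and the pointwise bound applies under positive weights.\<close>
    have "h T E + h T' E = (\<Sum>x\<in>X\<^sub>s E. w\<^sub>s E x * (G T E x + G T' E x))"
      by (simp add: h_def quad_inner_def sum.distrib distrib_left)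
    also have "\<dots> \<ge> 0"
      using surf_quad[OF T(1) E(1)] pointwise by (intro sum_nonneg mult_nonneg_nonneg) (auto intro: less_imp_le)
    finally show "0 \<le> h T E + h T' E" .
  qed
  have split: "(\<Sum>E | E facet_of T. h T E) = (\<Sum>E | E facet_of T \<and> E \<subseteq> frontier \<Omega>. h T E)
      + (\<Sum>E | E facet_of T \<and> \<not> E \<subseteq> frontier \<Omega>. h T E)" if "T \<in> \<T>" for T
    using simp\<T>(3)[OF that] by (subst sum.union_disjoint[symmetric]) (auto intro!: sum.cong)
  have "(\<Sum>T\<in>\<T>. elem_bd_inner X\<^sub>s w\<^sub>s T (G T) (\<lambda>E x. 1))
      = domain_bd_inner \<Omega> \<T> X\<^sub>s w\<^sub>s G (\<lambda>T E x. 1)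
        + (\<Sum>T\<in>\<T>. \<Sum>E | E facet_of T \<and> \<not> E \<subseteq> frontier \<Omega>. h T E)"
    by (simp add: elem_bd_inner_def domain_bd_inner_def fun_cong[OF fun_cong[OF h_def[symmetric]]] split sum.distrib)
  then show ?thesis
    using local_ineq interior by (simp add: domain_inner_def sum.distrib)
qed

end
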